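(* The operator $h:W\to W$, $h(\hat w)=\big((\hat e_i\hat e_j)\hat w_j\big)\otimes e_i$ for $\hat w=\hat w_j\otimes e_j\in W=\mathbb O\otimes_{\mathbb R}V$, is self-adjoint with respect to the natural Euclidean inner product on $W$, and is $G_2$-equivariant with respect to the diagonal action of $G_2$ on $W$.
   Context: $\mathbb O$ is the octonion algebra with inner product $\langle x,y\rangle_{\mathbb O}=\operatorname{Re}(x\bar y)$. $V$ is an oriented Euclidean $7$-dimensional real vector space with metric $g$ and a fixed isometric identification $V\cong\hat V:=\operatorname{Im}\mathbb O$, $v\mapsto\hat v$; only hatted vectors are multiplied in $\mathbb O$. $G_2=\operatorname{Aut}(\mathbb O)$ acts on $\operatorname{Im}\mathbb O$ and, via the identification, on $V$. On $W=\mathbb O\otimes_{\mathbb R}V$ the inner product is determined by $\langle x\otimes v,y\otimes w\rangle_W=\langle x,y\rangle_{\mathbb O}\,g(v,w)$ and the diagonal action by $\gamma\cdot(x\otimes v)=\gamma(x)\otimes\gamma(v)$. $e_1,\dots,e_7$ is an orthonormal basis of $V$, $\hat e_1,\dots,\hat e_7$ the corresponding basis of $\hat V$, and repeated indices are summed; $h$ does not depend on the choice of basis. *)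

theory Defs
  imports "HOL-Analysis.Analysis"
begin

section \<open>Octonions\<close>

text \<open>
  The octonions are obtained from the complex numbers by applying the Cayley-Dickson doubling
  \<open>(a, b) (c, d) = (a c - conj d b, d a + b conj c)\<close>, \<open>conj (a, b) = (conj a, - b)\<close> twice.
\<close>

type_synonym quat = "complex \<times> complex"

definition quat_mult :: "quat \<Rightarrow> quat \<Rightarrow> quat"
  where "quat_mult p q =
    (fst p * fst q - cnj (snd q) * snd p, snd q * fst p + snd p * cnj (fst q))"

definition quat_cnj :: "quat \<Rightarrow> quat"
  where "quat_cnj p = (cnj (fst p), - snd p)"

typedef octonion = "UNIV :: (quat \<times> quat) set"
  morphisms quat_pair Octonion ..

setup_lifting type_definition_octonion

lift_definition oct_cnj :: "octonion \<Rightarrow> octonion"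
  is "\<lambda>x. (quat_cnj (fst x), - snd x)" .

lift_definition oct_Re :: "octonion \<Rightarrow> real"
  is "\<lambda>x. Re (fst (fst x))" .

instantiation octonion :: "{one, times}"
begin

lift_definition one_octonion :: octonion
  is "((1, 0), (0, 0))" .

lift_definition times_octonion :: "octonion \<Rightarrow> octonion \<Rightarrow> octonion"
  is "\<lambda>x y. (quat_mult (fst x) (fst y) - quat_mult (quat_cnj (snd y)) (snd x),
             quat_mult (snd y) (fst x) + quat_mult (snd x) (quat_cnj (fst y)))" .

instance ..

end

instantiation octonion :: real_vector
begin

lift_definition zero_octonion :: octonion is 0 .
lift_definition plus_octonion :: "octonion \<Rightarrow> octonion \<Rightarrow> octonion" is "(+)" .
lift_definition minus_octonion :: "octonion \<Rightarrow> octonion \<Rightarrow> octonion" is "(-)" .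
lift_definition uminus_octonion :: "octonion \<Rightarrow> octonion" is uminus .
lift_definition scaleR_octonion :: "real \<Rightarrow> octonion \<Rightarrow> octonion" is scaleR .

instance
  by standard (transfer; simp add: algebra_simps)+

end

instantiation octonion :: real_inner
begin

definition inner_octonion :: "octonion \<Rightarrow> octonion \<Rightarrow> real"
  where "inner_octonion x y = oct_Re (x * oct_cnj y)"

definition norm_octonion :: "octonion \<Rightarrow> real"
  where "norm_octonion x = sqrt (inner x x)"

definition sgn_octonion :: "octonion \<Rightarrow> octonion"
  where "sgn_octonion x = x /\<^sub>R norm x"

definition dist_octonion :: "octonion \<Rightarrow> octonion \<Rightarrow> real"
  where "dist_octonion x y = norm (x - y)"

definition uniformity_octonion :: "(octonion \<times> octonion) filter"
  where "uniformity_octonion = (INF e\<in>{0 <..}. principal {(x, y). dist x y < e})"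

definition open_octonion :: "octonion set \<Rightarrow> bool"
  where "open_octonion U \<longleftrightarrow>
    (\<forall>x\<in>U. eventually (\<lambda>(x', y). x' = x \<longrightarrow> y \<in> U) uniformity)"

lemma inner_octonion_quat_pair: "inner x y = inner (quat_pair x) (quat_pair y)"
  unfolding inner_octonion_def
  by transfer (auto simp: quat_mult_def quat_cnj_def inner_prod_def inner_complex_def)

instance
proof
  fix x y z :: octonion and r :: real
  show "dist x y = norm (x - y)"
    by (fact dist_octonion_def)
  show "sgn x = x /\<^sub>R norm x"
    by (fact sgn_octonion_def)
  show "uniformity = (INF e\<in>{0 <..}. principal {(x :: octonion, y). dist x y < e})"
    by (fact uniformity_octonion_def)
  show "open U \<longleftrightarrow> (\<forall>x\<in>U. eventually (\<lambda>(x', y). x' = x \<longrightarrow> y \<in> U) uniformity)"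
    for U :: "octonion set"
    by (fact open_octonion_def)
  show "inner x y = inner y x"
    by (simp add: inner_octonion_quat_pair inner_commute)
  show "inner (x + y) z = inner x z + inner y z"
    by (simp add: inner_octonion_quat_pair plus_octonion.rep_eq inner_add_left)
  show "inner (r *\<^sub>R x) y = r * inner x y"
    by (simp add: inner_octonion_quat_pair scaleR_octonion.rep_eq)
  show "0 \<le> inner x x"
    by (simp add: inner_octonion_quat_pair)
  show "inner x x = 0 \<longleftrightarrow> x = 0"
    by (simp add: inner_octonion_quat_pair zero_octonion.rep_eq flip: quat_pair_inject)
  show "norm x = sqrt (inner x x)"
    by (fact norm_octonion_def)
qed

end

instantiation octonion :: euclidean_space
begin

definition Basis_octonion :: "octonion set"
  where "Basis_octonion = Octonion ` Basis"

instance
proof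
  show "(Basis :: octonion set) \<noteq> {}" "finite (Basis :: octonion set)"
    by (simp_all add: Basis_octonion_def)
  show "inner u v = (if u = v then 1 else 0)" if "u \<in> Basis" "v \<in> Basis" for u v :: octonion
  proof -
    from that obtain p q where "u = Octonion p" "v = Octonion q" "p \<in> Basis" "q \<in> Basis"
      unfolding Basis_octonion_def by blast
    then show ?thesis
      by (simp add: inner_octonion_quat_pair Octonion_inverse Octonion_inject inner_Basis
          del: inner_Pair split_paired_All)
  qed
  show "(\<forall>u\<in>Basis. inner x u = 0) \<longleftrightarrow> x = 0" for x :: octonion
    by (simp add: Basis_octonion_def inner_octonion_quat_pair Octonion_inverse
        zero_octonion.rep_eq euclidean_all_zero_iff flip: quat_pair_inject)
qed

end

lemma DIM_octonion: "DIM(octonion) = 8"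
proof -
  have "inj_on Octonion Basis"
    by (auto simp: inj_on_def Octonion_inject)
  then show ?thesis
    by (simp add: Basis_octonion_def card_image)
qed

lemma bilinear_octonion_times: "bilinear ((*) :: octonion \<Rightarrow> octonion \<Rightarrow> octonion)"
proof -
  have "x * (y + z) = x * y + x * z" "(x + y) * z = x * z + y * z" for x y z :: octonion
    by (transfer; simp add: quat_mult_def quat_cnj_def prod_eq_iff algebra_simps)+
  moreover have "x * (c *\<^sub>R y) = c *\<^sub>R (x * y)" "(c *\<^sub>R x) * y = c *\<^sub>R (x * y)"
    for x y :: octonion and c :: real
    by (transfer; simp add: quat_mult_def quat_cnj_def prod_eq_iff scaleR_right_diff_distrib
        scaleR_right_distrib)+
  ultimately show ?thesis
    by (simp add: bilinear_def linear_iff)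
qed

lemma octonion_times_one: "x * 1 = x" "1 * x = x" for x :: octonion
  by (transfer; auto simp: quat_mult_def quat_cnj_def prod_eq_iff)+

lemma norm_octonion_times: "norm (x * y) = norm x * norm y" for x y :: octonion
proof -
  have "inner (x * y) (x * y) = inner x x * inner y y"
    unfolding inner_octonion_quat_pair
    by (transfer, simp add: quat_mult_def quat_cnj_def inner_prod_def inner_complex_def, algebra)
  then show ?thesis
    by (simp add: norm_octonion_def real_sqrt_mult)
qed

definition Im_octonion :: "octonion set"
  where "Im_octonion = {x. oct_Re x = 0}"

definition G2 :: "(octonion \<Rightarrow> octonion) set"
  where "G2 = {\<gamma>. linear \<gamma> \<and> bij \<gamma> \<and> \<gamma> 1 = 1 \<and> (\<forall>x y. \<gamma> (x * y) = \<gamma> x * \<gamma> y)}"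

lemma octonion_square: "x * x = (2 * oct_Re x) *\<^sub>R x - (inner x x) *\<^sub>R 1"
  unfolding inner_octonion_quat_pair
  by transfer
     (simp add: quat_mult_def quat_cnj_def inner_prod_def inner_complex_def prod_eq_iff
       complex_eq_iff)

lemma G2_Im_octonion:
  assumes "\<gamma> \<in> G2" "x \<in> Im_octonion"
  shows "\<gamma> x \<in> Im_octonion"
proof (rule ccontr)
  assume "\<gamma> x \<notin> Im_octonion"
  then have ne: "oct_Re (\<gamma> x) \<noteq> 0"
    by (simp add: Im_octonion_def)
  have \<gamma>: "linear \<gamma>" "inj \<gamma>" "\<gamma> 1 = 1" "\<gamma> (x * x) = \<gamma> x * \<gamma> x"
    using assms(1) by (auto simp: G2_def bij_def)
  have x: "oct_Re x = 0"
    using assms(2) by (simp add: Im_octonion_def)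
  have "x * x = - inner x x *\<^sub>R 1"
    using octonion_square[of x] x by simp
  then have "\<gamma> x * \<gamma> x = - inner x x *\<^sub>R 1"
    using \<gamma>(3) unfolding \<gamma>(4)[symmetric] by (simp only: linear_scale[OF \<gamma>(1)])
  then have "(2 * oct_Re (\<gamma> x)) *\<^sub>R \<gamma> x = (inner (\<gamma> x) (\<gamma> x) - inner x x) *\<^sub>R 1"
    using octonion_square[of "\<gamma> x"] by (simp add: algebra_simps)
  then have "(1 / (2 * oct_Re (\<gamma> x))) *\<^sub>R (2 * oct_Re (\<gamma> x)) *\<^sub>R \<gamma> x =
      (1 / (2 * oct_Re (\<gamma> x))) *\<^sub>R (inner (\<gamma> x) (\<gamma> x) - inner x x) *\<^sub>R 1"
    by (rule arg_cong)
  then obtain c where c: "\<gamma> x = c *\<^sub>R 1"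
    using ne by auto
  then have "\<gamma> x = \<gamma> (c *\<^sub>R 1)"
    using \<gamma> by (simp add: linear_scale)
  then have "x = c *\<^sub>R 1"
    using \<gamma>(2) by (simp add: inj_eq)
  moreover have "oct_Re (c *\<^sub>R 1) = c"
    by transfer simp
  ultimately have "c = 0"
    using x by simp
  moreover have "oct_Re (0 *\<^sub>R 1) = 0"
    by transfer simp
  ultimately show False
    using ne c by simp
qed


section \<open>Tensor products of real vector spaces\<close>

text \<open>
  A tensor is represented by a formal finite sum of pairs; two formal sums denote the same tensor
  iff every real-valued bilinear map takes the same value on them.  Over a field, bilinear forms
  separate the points of the algebraic tensor product, so this is the usual quotient of the free
  vector space by the bilinearity relations; its universal property is proved below.
\<close>

definition tensor_eq ::
  "('a::real_vector \<times> 'b::real_vector) list \<Rightarrow> ('a \<times> 'b) list \<Rightarrow> bool"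
  where "tensor_eq l m \<longleftrightarrow>
    (\<forall>B :: 'a \<Rightarrow> 'b \<Rightarrow> real. bilinear B \<longrightarrow> (\<Sum>(x, y)\<leftarrow>l. B x y) = (\<Sum>(x, y)\<leftarrow>m. B x y))"

lemma equivp_tensor_eq: "equivp tensor_eq"
  by (rule equivpI) (auto simp: reflp_def symp_def transp_def tensor_eq_def)

quotient_type (overloaded) ('a, 'b) tensor = "('a::real_vector \<times> 'b::real_vector) list" / tensor_eq
  by (fact equivp_tensor_eq)

lift_definition pure_tensor ::
  "'a::real_vector \<Rightarrow> 'b::real_vector \<Rightarrow> ('a, 'b) tensor" (infix "\<otimes>" 75)
  is "\<lambda>x y. [(x, y)]" .

lemma bilinear_scale_list:
  assumes "bilinear B"
  shows "(\<Sum>(x, y)\<leftarrow>map (\<lambda>(x, y). (c *\<^sub>R x, y)) l. B x y) = c *\<^sub>R (\<Sum>(x, y)\<leftarrow>l. B x y)"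
  using assms by (induction l) (auto simp: bilinear_lmul scaleR_add_right)

instantiation tensor :: (real_vector, real_vector) real_vector
begin

lift_definition zero_tensor :: "('a, 'b) tensor"
  is "[]" .

lift_definition plus_tensor :: "('a, 'b) tensor \<Rightarrow> ('a, 'b) tensor \<Rightarrow> ('a, 'b) tensor"
  is "(@)"
  by (simp add: tensor_eq_def)

lift_definition scaleR_tensor :: "real \<Rightarrow> ('a, 'b) tensor \<Rightarrow> ('a, 'b) tensor"
  is "\<lambda>c. map (\<lambda>(x, y). (c *\<^sub>R x, y))"
  by (simp add: tensor_eq_def bilinear_scale_list del: map_map)

definition uminus_tensor :: "('a, 'b) tensor \<Rightarrow> ('a, 'b) tensor"
  where "uminus_tensor s = (-1) *\<^sub>R s"

definition minus_tensor :: "('a, 'b) tensor \<Rightarrow> ('a, 'b) tensor \<Rightarrow> ('a, 'b) tensor"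
  where "minus_tensor s t = s + - t"

instance
proof
  fix s t u :: "('a, 'b) tensor" and c d :: real
  show "s + t + u = s + (t + u)" "s + t = t + s" "0 + s = s"
    by (transfer; simp add: tensor_eq_def)+
  show "c *\<^sub>R (s + t) = c *\<^sub>R s + c *\<^sub>R t" "(c + d) *\<^sub>R s = c *\<^sub>R s + d *\<^sub>R s"
       "c *\<^sub>R d *\<^sub>R s = (c * d) *\<^sub>R s" "1 *\<^sub>R s = s"
    by (transfer; simp add: tensor_eq_def bilinear_scale_list distrib_left distrib_right mult.assoc
        del: map_map)+
  show "- s + s = 0"
    unfolding uminus_tensor_def
    by transfer (simp add: tensor_eq_def bilinear_scale_list del: map_map scaleR_minus_left scaleR_minus1_left)
  show "s - t = s + - t"
    by (fact minus_tensor_def)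
qed

end

lemma bilinear_pure_tensor: "bilinear (\<otimes>)"
  unfolding bilinear_def linear_iff
  by (intro conjI allI; transfer)
     (auto simp: tensor_eq_def bilinear_ladd bilinear_radd bilinear_lmul bilinear_rmul)

lemma tensor_induct [case_names pure add]:
  assumes pure: "\<And>x y. P (x \<otimes> y)"
    and add: "\<And>s t. P s \<Longrightarrow> P t \<Longrightarrow> P (s + t)"
  shows "P t"
proof -
  have zero: "P 0"
    using pure[of 0 0] by (simp add: bilinear_lzero[OF bilinear_pure_tensor])
  have "P (abs_tensor l)" for l
  proof (induction l)
    case Nil
    then show ?case
      using zero by (simp add: zero_tensor_def)
  next
    case (Cons p l)
    obtain x y where p: "p = (x, y)"
      by (cases p)
    have "abs_tensor (p # l) = x \<otimes> y + abs_tensor l"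
      by (simp add: p pure_tensor.abs_eq plus_tensor.abs_eq)
    then show ?case
      using add[OF pure Cons.IH] by simp
  qed
  then show ?thesis
    by (rule tensor.abs_induct)
qed

lemma bilinear_coordinates:
  fixes B :: "'a::euclidean_space \<Rightarrow> 'b::euclidean_space \<Rightarrow> 'c::real_vector"
  assumes "bilinear B"
  shows "(\<Sum>(x, y)\<leftarrow>l. B x y) =
    (\<Sum>i\<in>Basis. \<Sum>j\<in>Basis. (\<Sum>(x, y)\<leftarrow>l. inner x i * inner y j) *\<^sub>R B i j)"
proof (induction l)
  case Nil
  then show ?case by simp
next
  case (Cons p l)
  obtain x y where p: "p = (x, y)"
    by (cases p)
  have "B x y = B (\<Sum>i\<in>Basis. inner x i *\<^sub>R i) (\<Sum>j\<in>Basis. inner y j *\<^sub>R j)"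
    by (simp add: euclidean_representation)
  also have "\<dots> = (\<Sum>i\<in>Basis. \<Sum>j\<in>Basis. (inner x i * inner y j) *\<^sub>R B i j)"
    unfolding bilinear_sum[OF assms] sum.cartesian_product
    by (simp add: bilinear_lmul[OF assms] bilinear_rmul[OF assms] mult.commute)
  finally show ?case
    using Cons.IH by (simp add: p scaleR_add_left sum.distrib)
qed

lemma bilinear_inner_times:
  "bilinear (\<lambda>x y. inner x a * inner y b)"
  by (auto simp: bilinear_def linear_iff algebra_simps)

lemma tensor_eq_coordinates:
  assumes "tensor_eq l m"
  shows "(\<Sum>(x, y)\<leftarrow>l. inner x a * inner y b) = (\<Sum>(x, y)\<leftarrow>m. inner x a * inner y b)"
  using assms bilinear_inner_times[of a b] unfolding tensor_eq_def by blast

lemma bilinear_sum_list: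
  assumes "\<And>p. bilinear (f p :: 'a::real_vector \<Rightarrow> 'b::real_vector \<Rightarrow> 'c::real_vector)"
  shows "bilinear (\<lambda>x y. \<Sum>p\<leftarrow>m. f p x y)"
proof (induction m)
  case Nil
  then show ?case by (simp add: bilinear_def linear_iff)
next
  case (Cons p m)
  then show ?case
    using assms[of p] by (auto simp: bilinear_def linear_iff algebra_simps)
qed

lemma tensor_eqD:
  fixes B :: "'a::euclidean_space \<Rightarrow> 'b::euclidean_space \<Rightarrow> 'c::real_vector"
  assumes "tensor_eq l m" "bilinear B"
  shows "(\<Sum>(x, y)\<leftarrow>l. B x y) = (\<Sum>(x, y)\<leftarrow>m. B x y)"
  unfolding bilinear_coordinates[OF assms(2)] tensor_eq_coordinates[OF assms(1)] ..

theorem tensor_universal_property: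
  fixes B :: "'a::euclidean_space \<Rightarrow> 'b::euclidean_space \<Rightarrow> 'c::real_vector"
  assumes "bilinear B"
  shows "\<exists>!f. linear f \<and> (\<forall>x y. f (x \<otimes> y) = B x y)"
proof -
  define f where "f t = (\<Sum>(x, y)\<leftarrow>rep_tensor t. B x y)" for t
  have f: "f (abs_tensor l) = (\<Sum>(x, y)\<leftarrow>l. B x y)" for l
    unfolding f_def
    by (rule tensor_eqD[OF _ assms]) (rule Quotient3_rep_abs[OF Quotient3_tensor], simp add: tensor_eq_def)
  have "linear f"
    unfolding linear_iff
  proof (intro conjI allI)
    fix s t :: "('a, 'b) tensor" and c :: real
    obtain l m where lm: "s = abs_tensor l" "t = abs_tensor m"
      by (metis Quotient3_abs_rep[OF Quotient3_tensor])
    show "f (s + t) = f s + f t"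
      by (simp add: lm plus_tensor.abs_eq f)
    show "f (c *\<^sub>R s) = c *\<^sub>R f s"
      by (simp add: lm scaleR_tensor.abs_eq f bilinear_scale_list[OF assms] del: map_map)
  qed
  moreover have "f (x \<otimes> y) = B x y" for x y
    by (simp add: pure_tensor.abs_eq f)
  moreover have "g = h"
    if "linear g \<and> (\<forall>x y. g (x \<otimes> y) = B x y)" "linear h \<and> (\<forall>x y. h (x \<otimes> y) = B x y)"
    for g h :: "('a, 'b) tensor \<Rightarrow> 'c"
  proof
    show "g t = h t" for t
      using that by (induction t rule: tensor_induct) (auto simp: linear_add)
  qed
  ultimately show ?thesis
    by blast
qed

definition tensor_lift ::
  "('a::euclidean_space \<Rightarrow> 'b::euclidean_space \<Rightarrow> 'c::real_vector) \<Rightarrow> ('a, 'b) tensor \<Rightarrow> 'c"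
  where "tensor_lift B = (THE f. linear f \<and> (\<forall>x y. f (x \<otimes> y) = B x y))"

lemma tensor_lift:
  fixes B :: "'a::euclidean_space \<Rightarrow> 'b::euclidean_space \<Rightarrow> 'c::real_vector"
  assumes "bilinear B"
  shows "linear (tensor_lift B)" "tensor_lift B (x \<otimes> y) = B x y"
  using theI'[OF tensor_universal_property[OF assms]] by (simp_all add: tensor_lift_def)

lemma inner_lists:
  fixes l m :: "('a::euclidean_space \<times> 'b::euclidean_space) list"
  shows "(\<Sum>(x, v)\<leftarrow>l. \<Sum>(y, w)\<leftarrow>m. inner x y * inner v w) =
    (\<Sum>i\<in>Basis. \<Sum>j\<in>Basis.
      (\<Sum>(x, v)\<leftarrow>l. inner x i * inner v j) * (\<Sum>(y, w)\<leftarrow>m. inner y i * inner w j))"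
proof -
  have "bilinear (\<lambda>x v. \<Sum>p\<leftarrow>m. inner x (fst p) * inner v (snd p))"
    by (intro bilinear_sum_list bilinear_inner_times)
  from bilinear_coordinates[OF this, of l] show ?thesis
    by (simp add: case_prod_unfold inner_commute)
qed

instantiation tensor :: (euclidean_space, euclidean_space) real_inner
begin

lift_definition inner_tensor :: "('a, 'b) tensor \<Rightarrow> ('a, 'b) tensor \<Rightarrow> real"
  is "\<lambda>l m. \<Sum>(x, v)\<leftarrow>l. \<Sum>(y, w)\<leftarrow>m. inner x y * inner v w"
  unfolding inner_lists by (simp only: tensor_eq_coordinates)

definition norm_tensor :: "('a, 'b) tensor \<Rightarrow> real"
  where "norm_tensor x = sqrt (inner x x)"

definition sgn_tensor :: "('a, 'b) tensor \<Rightarrow> ('a, 'b) tensor"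
  where "sgn_tensor x = x /\<^sub>R norm x"

definition dist_tensor :: "('a, 'b) tensor \<Rightarrow> ('a, 'b) tensor \<Rightarrow> real"
  where "dist_tensor x y = norm (x - y)"

definition uniformity_tensor :: "(('a, 'b) tensor \<times> ('a, 'b) tensor) filter"
  where "uniformity_tensor = (INF e\<in>{0 <..}. principal {(x, y). dist x y < e})"

definition open_tensor :: "('a, 'b) tensor set \<Rightarrow> bool"
  where "open_tensor U \<longleftrightarrow>
    (\<forall>x\<in>U. eventually (\<lambda>(x', y). x' = x \<longrightarrow> y \<in> U) uniformity)"

instance
proof
  fix x y z :: "('a, 'b) tensor" and r :: real
  show "dist x y = norm (x - y)"
    by (fact dist_tensor_def)
  show "sgn x = x /\<^sub>R norm x"
    by (fact sgn_tensor_def)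
  show "uniformity = (INF e\<in>{0 <..}. principal {(x :: ('a, 'b) tensor, y). dist x y < e})"
    by (fact uniformity_tensor_def)
  show "open U \<longleftrightarrow> (\<forall>x\<in>U. eventually (\<lambda>(x', y). x' = x \<longrightarrow> y \<in> U) uniformity)"
    for U :: "('a, 'b) tensor set"
    by (fact open_tensor_def)
  show "inner x y = inner y x"
    by transfer (simp add: inner_lists mult.commute)
  show "inner (x + y) z = inner x z + inner y z"
    by transfer simp
  show "inner (r *\<^sub>R x) y = r * inner x y"
    by transfer
       (simp add: inner_lists bilinear_scale_list[OF bilinear_inner_times] sum_distrib_left
         mult.assoc del: map_map)
  show "0 \<le> inner x x"
    by transfer (simp add: inner_lists sum_nonneg)
  show "inner x x = 0 \<longleftrightarrow> x = 0"
  proof (transfer, rule iffI)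
    fix l :: "('a \<times> 'b) list"
    assume "(\<Sum>(x, v)\<leftarrow>l. \<Sum>(y, w)\<leftarrow>l. inner x y * inner v w) = 0"
    then have "\<forall>i\<in>Basis. \<forall>j\<in>Basis. (\<Sum>(x, v)\<leftarrow>l. inner x i * inner v j) = 0"
      by (simp add: inner_lists sum_nonneg_eq_0_iff sum_nonneg)
    then show "tensor_eq l []"
      by (simp add: tensor_eq_def bilinear_coordinates)
  next
    fix l :: "('a \<times> 'b) list"
    assume "tensor_eq l []"
    then have "(\<Sum>(x, v)\<leftarrow>l. inner x i * inner v j) = 0" for i j
      by (simp add: tensor_eq_coordinates)
    then show "(\<Sum>(x, v)\<leftarrow>l. \<Sum>(y, w)\<leftarrow>l. inner x y * inner v w) = 0"
      by (simp add: inner_lists)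
  qed
  show "norm x = sqrt (inner x x)"
    by (fact norm_tensor_def)
qed

end

lemma inner_pure_tensor: "inner (x \<otimes> v) (y \<otimes> w) = inner x y * inner v w"
  by transfer simp


section \<open>The operator \<open>h\<close>\<close>

definition orthonormal_basis :: "('i::finite \<Rightarrow> 'v::real_inner) \<Rightarrow> bool"
  where "orthonormal_basis e \<longleftrightarrow>
    (\<forall>i j. inner (e i) (e j) = (if i = j then 1 else 0)) \<and> span (range e) = UNIV"

definition isometric_identification :: "('v::real_inner \<Rightarrow> octonion) \<Rightarrow> bool"
  where "isometric_identification hat \<longleftrightarrow>
    linear hat \<and> (\<forall>v w. inner (hat v) (hat w) = inner v w) \<and> range hat = Im_octonion"

text \<open>
  Automorphisms of the octonions preserve the imaginary octonions, so \<open>inv hat\<close> is only applied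
  to points in the range of \<open>hat\<close> when \<open>\<gamma> \<in> G2\<close>.
\<close>

definition G2_act_V :: "('v::real_inner \<Rightarrow> octonion) \<Rightarrow> (octonion \<Rightarrow> octonion) \<Rightarrow> 'v \<Rightarrow> 'v"
  where "G2_act_V hat \<gamma> v = inv hat (\<gamma> (hat v))"

definition G2_act_W ::
  "('v::euclidean_space \<Rightarrow> octonion) \<Rightarrow> (octonion \<Rightarrow> octonion)
    \<Rightarrow> (octonion, 'v) tensor \<Rightarrow> (octonion, 'v) tensor"
  where "G2_act_W hat \<gamma> = tensor_lift (\<lambda>x v. \<gamma> x \<otimes> G2_act_V hat \<gamma> v)"

lemma hat_G2_act_V:
  assumes "isometric_identification hat" "\<gamma> \<in> G2"
  shows "hat (G2_act_V hat \<gamma> v) = \<gamma> (hat v)"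
proof -
  have "\<gamma> (hat v) \<in> range hat"
    using assms(1) G2_Im_octonion[OF assms(2), of "hat v"]
    by (metis isometric_identification_def rangeI)
  then show ?thesis
    by (simp add: G2_act_V_def f_inv_into_f)
qed

lemma linear_G2_act_V:
  assumes "isometric_identification hat" "\<gamma> \<in> G2"
  shows "linear (G2_act_V hat \<gamma>)"
proof -
  have hat: "linear hat" "\<And>v w. inner (hat v) (hat w) = inner v w"
    using assms(1) by (auto simp: isometric_identification_def)
  have inj: "v = w" if "hat v = hat w" for v w
  proof -
    have "inner (v - w) (v - w) = 0"
      by (simp add: that linear_diff[OF hat(1)] flip: hat(2))
    then show ?thesis by simp
  qed
  have "linear \<gamma>"
    using assms(2) by (simp add: G2_def)
  then show ?thesis
    unfolding linear_iff
    by (intro conjI allI inj)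
       (simp_all add: hat_G2_act_V[OF assms] linear_add linear_scale hat(1))
qed

lemma G2_act_W_pure:
  assumes "isometric_identification hat" "\<gamma> \<in> G2"
  shows "linear (G2_act_W hat \<gamma>)"
    and "G2_act_W hat \<gamma> (x \<otimes> v) = \<gamma> x \<otimes> G2_act_V hat \<gamma> v"
proof -
  have "linear \<gamma>"
    using assms(2) by (simp add: G2_def)
  then have "bilinear (\<lambda>x v. \<gamma> x \<otimes> G2_act_V hat \<gamma> v)"
    using linear_G2_act_V[OF assms]
    by (auto simp: bilinear_def linear_iff bilinear_ladd[OF bilinear_pure_tensor]
        bilinear_radd[OF bilinear_pure_tensor] bilinear_lmul[OF bilinear_pure_tensor]
        bilinear_rmul[OF bilinear_pure_tensor])
  from tensor_lift[OF this]
  show "linear (G2_act_W hat \<gamma>)" "G2_act_W hat \<gamma> (x \<otimes> v) = \<gamma> x \<otimes> G2_act_V hat \<gamma> v"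
    by (simp_all add: G2_act_W_def)
qed

text \<open>
  For an orthonormal basis \<open>e\<close> every tensor is \<open>\<Sum>j. w j \<otimes> e j\<close> for exactly one family \<open>w\<close> of
  octonions (see \<open>tensor_components\<close>), so the description below is proper.  As octonion
  multiplication is not associative, the bracketing matters.
\<close>

definition h_op ::
  "('v::euclidean_space \<Rightarrow> octonion) \<Rightarrow> (7 \<Rightarrow> 'v) \<Rightarrow> (octonion, 'v) tensor \<Rightarrow> (octonion, 'v) tensor"
  where "h_op hat e t =
    (let w = (THE w. t = (\<Sum>j\<in>UNIV. w j \<otimes> e j))
     in \<Sum>i\<in>UNIV. (\<Sum>j\<in>UNIV. (hat (e i) * hat (e j)) * w j) \<otimes> e i)"

lemma tensor_components:
  fixes e :: "'i::finite \<Rightarrow> 'v::euclidean_space" and t :: "('a::euclidean_space, 'v) tensor"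
  assumes "orthonormal_basis e"
  shows "\<exists>!w. t = (\<Sum>j\<in>UNIV. w j \<otimes> e j)"
proof -
  note bl = bilinear_pure_tensor
  have e: "inner (e i) (e j) = (if i = j then 1 else 0)" for i j
    using assms by (simp add: orthonormal_basis_def)
  have expand: "v = (\<Sum>j\<in>UNIV. inner v (e j) *\<^sub>R e j)" for v
  proof -
    have "v \<in> span (range e)"
      using assms by (simp add: orthonormal_basis_def)
    then show ?thesis
    proof (induction rule: span_induct_alt)
      case base
      then show ?case by simp
    next
      case (step c x y)
      from \<open>x \<in> range e\<close> obtain k where k: "x = e k" by auto
      have "(\<Sum>j\<in>UNIV. inner x (e j) *\<^sub>R e j) = (\<Sum>j\<in>UNIV. if k = j then e j else 0)"
        by (rule sum.cong) (auto simp: k e)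
      then have "(\<Sum>j\<in>UNIV. inner x (e j) *\<^sub>R e j) = x"
        by (simp add: k)
      moreover have "(\<Sum>j\<in>UNIV. inner (c *\<^sub>R x + y) (e j) *\<^sub>R e j) =
          c *\<^sub>R (\<Sum>j\<in>UNIV. inner x (e j) *\<^sub>R e j) + (\<Sum>j\<in>UNIV. inner y (e j) *\<^sub>R e j)"
        by (simp add: inner_add_left scaleR_add_left sum.distrib scaleR_sum_right)
      ultimately show ?case
        using step.IH by metis
    qed
  qed
  have "\<exists>w. t = (\<Sum>j\<in>UNIV. w j \<otimes> e j)"
  proof (induction t rule: tensor_induct)
    case (pure x v)
    have lin: "linear (\<lambda>v. x \<otimes> v)"
      using bl unfolding bilinear_def by blast
    have "x \<otimes> v = x \<otimes> (\<Sum>j\<in>UNIV. inner v (e j) *\<^sub>R e j)"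
      by (rule arg_cong[OF expand])
    also have "\<dots> = (\<Sum>j\<in>UNIV. (inner v (e j) *\<^sub>R x) \<otimes> e j)"
      by (simp add: linear_sum[OF lin] bilinear_lmul[OF bl] bilinear_rmul[OF bl])
    finally show ?case
      by (rule exI[where x = "\<lambda>j. inner v (e j) *\<^sub>R x"])
  next
    case (add s t)
    then obtain u w where "s = (\<Sum>j\<in>UNIV. u j \<otimes> e j)" "t = (\<Sum>j\<in>UNIV. w j \<otimes> e j)"
      by blast
    then have "s + t = (\<Sum>j\<in>UNIV. (u j + w j) \<otimes> e j)"
      by (simp add: bilinear_ladd[OF bl] sum.distrib)
    then show ?case
      by (rule exI[where x = "\<lambda>j. u j + w j"])
  qed
  moreover have "u = w" if "(\<Sum>j\<in>UNIV. u j \<otimes> e j) = (\<Sum>j\<in>UNIV. w j \<otimes> e j)"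
    for u w :: "'i \<Rightarrow> 'a"
  proof
    fix k
    define C where "C = tensor_lift (\<lambda>(x :: 'a) v. inner v (e k) *\<^sub>R x)"
    have "bilinear (\<lambda>(x :: 'a) v. inner v (e k) *\<^sub>R x)"
      by (auto simp: bilinear_def linear_iff algebra_simps)
    note C = tensor_lift[OF this, folded C_def]
    have "C (\<Sum>j\<in>UNIV. w j \<otimes> e j) = w k" for w
    proof -
      have "C (\<Sum>j\<in>UNIV. w j \<otimes> e j) = (\<Sum>j\<in>UNIV. if j = k then w j else 0)"
        unfolding linear_sum[OF C(1)] by (rule sum.cong) (auto simp: C e)
      then show ?thesis by simp
    qed
    then show "u k = w k"
      using that by metis
  qed
  ultimately show ?thesis by metis
qed

lemma h_op_eq:
  fixes e :: "7 \<Rightarrow> 'v::euclidean_space"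
  assumes "orthonormal_basis e"
  shows "h_op hat e (\<Sum>j\<in>UNIV. w j \<otimes> e j) =
    (\<Sum>i\<in>UNIV. (\<Sum>j\<in>UNIV. (hat (e i) * hat (e j)) * w j) \<otimes> e i)"
proof -
  have "(THE u. (\<Sum>j\<in>UNIV. w j \<otimes> e j) = (\<Sum>j\<in>UNIV. u j \<otimes> e j)) = w"
    by (rule the1_equality[OF tensor_components[OF assms] refl])
  then show ?thesis
    by (simp add: h_op_def)
qed

end

theory Submission
  imports Defs
begin

text \<open>
  The point of the proof is that \<open>h\<close> is determined by its matrix coefficients on pure tensors,
  \<open>\<langle>h (x \<otimes> v), y \<otimes> u\<rangle> = \<langle>(hat u * hat v) * x, y\<rangle>\<close>, and that these no longer mention the basis
  \<open>e\<close> (\<open>inner_h_op_pure\<close>): the \<open>i\<close>-th summand of \<open>h\<close> is paired with the \<open>i\<close>-th coordinate of \<open>u\<close>,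
  so that the basis expansion of \<open>u\<close> reassembles inside the product.

  Self-adjointness follows because the adjoint of left multiplication by \<open>a\<close> is left multiplication
  by the conjugate of \<open>a\<close>, even though the octonions are not associative, and because the conjugate
  of \<open>hat u * hat v\<close> is \<open>hat v * hat u\<close> when both factors are imaginary: exactly the exchange of
  the roles of \<open>u\<close> and \<open>v\<close>.

  Equivariance follows because \<open>\<gamma> \<in> G2\<close> preserves products, hence real parts and inner products.
  So it turns the coefficient of \<open>h\<close> between \<open>x \<otimes> v\<close> and \<open>y \<otimes> u\<close> into the one between their
  images.  Every pure tensor is such an image, and pure tensors separate the points of \<open>W\<close>.
\<close>

section \<open>Orthonormal bases and pure tensors\<close>

lemma orthonormal_basis_expansion:
  fixes e :: "'i::finite \<Rightarrow> 'v::real_inner"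
  assumes "orthonormal_basis e"
  shows "(\<Sum>j\<in>UNIV. inner v (e j) *\<^sub>R e j) = v"
proof -
  let ?d = "(\<Sum>j\<in>UNIV. inner v (e j) *\<^sub>R e j) - v"
  have e: "inner (e i) (e j) = (if i = j then 1 else 0)" for i j
    using assms by (simp add: orthonormal_basis_def)
  have "inner ?d (e k) = 0" for k
    by (simp add: inner_diff_left inner_sum_left e if_distrib cong: if_cong)
  then have "orthogonal ?d x" if "x \<in> range e" for x
    using that by (auto simp: orthogonal_def)
  moreover have "?d \<in> span (range e)"
    using assms by (simp add: orthonormal_basis_def)
  ultimately have "orthogonal ?d ?d"
    by (metis orthogonal_to_span)
  then show ?thesis
    by (simp add: orthogonal_def)
qed

text \<open>
  A tensor orthogonal to every pure tensor is orthogonal to itself, since the pure tensors span.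
\<close>

lemma tensor_eqI_inner_pure:
  fixes s t :: "('a::euclidean_space, 'b::euclidean_space) tensor"
  assumes "\<And>y u. inner s (y \<otimes> u) = inner t (y \<otimes> u)"
  shows "s = t"
proof -
  have "inner (s - t) r = 0" for r
    by (induction r rule: tensor_induct) (simp_all add: assms inner_diff_left inner_add_right)
  then show ?thesis
    by (metis inner_eq_zero_iff eq_iff_diff_eq_0)
qed

section \<open>Conjugation and automorphisms of the octonions\<close>

text \<open>
  This adjunction, which holds in every composition algebra by polarising the multiplicativity of
  the norm, is here a polynomial identity in the coordinates.
\<close>

lemma inner_octonion_times_left: "inner (a * x) y = inner x (oct_cnj a * y)"
  for a x y :: octonion
  unfolding inner_octonion_quat_pair
  by transfer (simp add: quat_mult_def quat_cnj_def inner_prod_def inner_complex_def algebra_simps)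

lemma oct_cnj_times: "oct_cnj (x * y) = oct_cnj y * oct_cnj x"
  by transfer (simp add: quat_mult_def quat_cnj_def prod_eq_iff algebra_simps)

lemma oct_cnj_eq: "oct_cnj x = (2 * oct_Re x) *\<^sub>R 1 - x"
  by transfer (simp add: quat_cnj_def prod_eq_iff complex_eq_iff)

lemma oct_cnj_Im_times_Im:
  assumes "x \<in> Im_octonion" "y \<in> Im_octonion"
  shows "oct_cnj (x * y) = y * x"
  using assms bilinear_lneg[OF bilinear_octonion_times] bilinear_rneg[OF bilinear_octonion_times]
  by (simp add: oct_cnj_times oct_cnj_eq[of x] oct_cnj_eq[of y] Im_octonion_def)

lemma linear_oct_Re: "linear oct_Re"
  unfolding linear_iff by (intro conjI allI; transfer; simp)

lemma oct_Re_one: "oct_Re 1 = 1"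
  by transfer simp

text \<open>
  An automorphism fixes \<open>1\<close> and maps imaginary octonions to imaginary ones, so it respects the
  splitting into real and imaginary parts.
\<close>

lemma G2_oct_Re:
  assumes "\<gamma> \<in> G2"
  shows "oct_Re (\<gamma> x) = oct_Re x"
proof -
  have \<gamma>: "linear \<gamma>" "\<gamma> 1 = 1"
    using assms by (simp_all add: G2_def)
  have "x - oct_Re x *\<^sub>R 1 \<in> Im_octonion"
    by (simp add: Im_octonion_def linear_diff[OF linear_oct_Re] linear_scale[OF linear_oct_Re]
        oct_Re_one)
  from G2_Im_octonion[OF assms this] show ?thesis
    by (simp add: Im_octonion_def linear_diff[OF linear_oct_Re] linear_scale[OF linear_oct_Re]
        oct_Re_one linear_diff[OF \<gamma>(1)] linear_scale[OF \<gamma>(1)] \<gamma>(2))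
qed

text \<open>
  The inner product is \<open>oct_Re (x * oct_cnj y)\<close>, built from operations that \<open>\<gamma>\<close> respects.
\<close>

lemma G2_inner:
  assumes "\<gamma> \<in> G2"
  shows "inner (\<gamma> x) (\<gamma> y) = inner x y"
proof -
  have \<gamma>: "linear \<gamma>" "\<gamma> 1 = 1" "\<And>x y. \<gamma> (x * y) = \<gamma> x * \<gamma> y"
    using assms by (simp_all add: G2_def)
  have "oct_cnj (\<gamma> y) = \<gamma> (oct_cnj y)"
    by (simp add: oct_cnj_eq G2_oct_Re[OF assms] linear_diff[OF \<gamma>(1)] linear_scale[OF \<gamma>(1)] \<gamma>(2))
  then show ?thesis
    by (simp add: inner_octonion_def G2_oct_Re[OF assms] flip: \<gamma>(3))
qed

section \<open>The diagonal action is by isometries\<close>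

lemma G2_act_V_inner:
  assumes "isometric_identification hat" "\<gamma> \<in> G2"
  shows "inner (G2_act_V hat \<gamma> v) (G2_act_V hat \<gamma> w) = inner v w"
  using assms(1) G2_inner[OF assms(2)] hat_G2_act_V[OF assms]
  by (metis isometric_identification_def)

lemma surj_G2_act_V:
  fixes hat :: "'v::euclidean_space \<Rightarrow> octonion"
  assumes "isometric_identification hat" "\<gamma> \<in> G2"
  shows "surj (G2_act_V hat \<gamma>)"
proof -
  have "v = 0" if "G2_act_V hat \<gamma> v = 0" for v
    using G2_act_V_inner[OF assms, of v v] that by simp
  then have "inj (G2_act_V hat \<gamma>)"
    by (simp add: linear_injective_0[OF linear_G2_act_V[OF assms]])
  then show ?thesis
    by (rule linear_inj_imp_surj[OF linear_G2_act_V[OF assms]])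
qed

lemma G2_act_W_inner:
  assumes "isometric_identification hat" "\<gamma> \<in> G2"
  shows "inner (G2_act_W hat \<gamma> s) (G2_act_W hat \<gamma> t) = inner s t"
proof (induction s rule: tensor_induct)
  case (pure x v)
  show ?case
    by (induction t rule: tensor_induct)
       (simp_all add: G2_act_W_pure[OF assms] linear_add inner_pure_tensor inner_add_right
         G2_inner[OF assms(2)] G2_act_V_inner[OF assms])
qed (simp add: linear_add[OF G2_act_W_pure(1)[OF assms]] inner_add_left)

section \<open>The operator \<open>h\<close>\<close>

lemma linear_h_op:
  fixes e :: "7 \<Rightarrow> 'v::euclidean_space"
  assumes "orthonormal_basis e"
  shows "linear (h_op hat e)"
proof -
  note bl = bilinear_pure_tensor and ml = bilinear_octonion_times
  show ?thesis
    unfolding linear_iff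
  proof (intro conjI allI)
    fix s t :: "(octonion, 'v) tensor" and c :: real
    obtain u w where s: "s = (\<Sum>j\<in>UNIV. u j \<otimes> e j)" and t: "t = (\<Sum>j\<in>UNIV. w j \<otimes> e j)"
      using ex1_implies_ex[OF tensor_components[OF assms, where t = s]]
        ex1_implies_ex[OF tensor_components[OF assms, where t = t]] by (elim exE) (rule that)
    have st: "s + t = (\<Sum>j\<in>UNIV. (u j + w j) \<otimes> e j)"
      by (simp add: s t bilinear_ladd[OF bl] sum.distrib)
    show "h_op hat e (s + t) = h_op hat e s + h_op hat e t"
      unfolding st unfolding s t h_op_eq[OF assms]
      by (simp add: bilinear_radd[OF ml] bilinear_ladd[OF bl] sum.distrib)
    have cs: "c *\<^sub>R s = (\<Sum>j\<in>UNIV. (c *\<^sub>R u j) \<otimes> e j)"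
      by (simp add: s bilinear_lmul[OF bl] scaleR_sum_right)
    show "h_op hat e (c *\<^sub>R s) = c *\<^sub>R h_op hat e s"
      unfolding cs unfolding s h_op_eq[OF assms]
      by (simp add: bilinear_rmul[OF ml] bilinear_lmul[OF bl]
          flip: scaleR_sum_right)
  qed
qed

text \<open>
  The expansion of \<open>v\<close> in the basis \<open>e\<close> collapses the inner sum in the definition of \<open>h\<close>.
\<close>

lemma h_op_pure:
  fixes e :: "7 \<Rightarrow> 'v::euclidean_space"
  assumes "orthonormal_basis e" "linear hat"
  shows "h_op hat e (x \<otimes> v) = (\<Sum>i\<in>UNIV. ((hat (e i) * hat v) * x) \<otimes> e i)"
proof -
  note bl = bilinear_pure_tensor and ml = bilinear_octonion_times
  have lin: "linear (\<lambda>v :: 'v. x \<otimes> v)"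
    using bl unfolding bilinear_def by blast
  have lin': "linear (\<lambda>v. (hat a * hat v) * x)" for a
    by (simp add: linear_iff linear_add[OF assms(2)] linear_scale[OF assms(2)]
        bilinear_radd[OF ml] bilinear_ladd[OF ml] bilinear_rmul[OF ml] bilinear_lmul[OF ml])
  have collapse:
    "(\<Sum>j\<in>UNIV. inner v (e j) *\<^sub>R ((hat a * hat (e j)) * x)) = (hat a * hat v) * x" for a
    using linear_sum[OF lin', of a "\<lambda>j. inner v (e j) *\<^sub>R e j" UNIV]
    by (simp add: linear_scale[OF lin'] orthonormal_basis_expansion[OF assms(1)])
  have "x \<otimes> v = x \<otimes> (\<Sum>j\<in>UNIV. inner v (e j) *\<^sub>R e j)"
    by (simp add: orthonormal_basis_expansion[OF assms(1)])
  also have "\<dots> = (\<Sum>j\<in>UNIV. (inner v (e j) *\<^sub>R x) \<otimes> e j)"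
    by (simp add: linear_sum[OF lin] bilinear_lmul[OF bl] bilinear_rmul[OF bl])
  finally have "h_op hat e (x \<otimes> v) =
      (\<Sum>i\<in>UNIV. (\<Sum>j\<in>UNIV. inner v (e j) *\<^sub>R ((hat (e i) * hat (e j)) * x)) \<otimes> e i)"
    by (simp add: h_op_eq[OF assms(1)] bilinear_rmul[OF ml])
  then show ?thesis
    by (simp only: collapse)
qed

text \<open>
  The right-hand side does not involve \<open>e\<close>; this is why \<open>h\<close> does not depend on the basis, and both
  symmetry properties of \<open>h\<close> are read off from it.
\<close>

lemma inner_h_op_pure:
  assumes "orthonormal_basis e" "linear hat"
  shows "inner (h_op hat e (x \<otimes> v)) (y \<otimes> u) = inner ((hat u * hat v) * x) y"
proof -
  note ml = bilinear_octonion_times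
  have lin: "linear (\<lambda>u. inner ((hat u * hat v) * x) y)"
    by (simp add: linear_iff linear_add[OF assms(2)] linear_scale[OF assms(2)]
        bilinear_ladd[OF ml] bilinear_lmul[OF ml] inner_add_left)
  have "inner (h_op hat e (x \<otimes> v)) (y \<otimes> u) =
      (\<Sum>i\<in>UNIV. inner u (e i) * inner ((hat (e i) * hat v) * x) y)"
    by (simp add: h_op_pure[OF assms] inner_sum_left inner_pure_tensor inner_commute[of u]
        mult.commute)
  also have "\<dots> = inner ((hat u * hat v) * x) y"
    using linear_sum[OF lin, of "\<lambda>i. inner u (e i) *\<^sub>R e i" UNIV]
    by (simp add: linear_scale[OF lin] orthonormal_basis_expansion[OF assms(1)])
  finally show ?thesis .
qed

lemma h_op_self_adjoint:
  assumes "isometric_identification hat" "orthonormal_basis e"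
  shows "inner (h_op hat e s) t = inner s (h_op hat e t)"
proof -
  have hat: "linear hat" "hat a \<in> Im_octonion" for a
    using assms(1) by (auto simp: isometric_identification_def)
  note lin = linear_add[OF linear_h_op[OF assms(2)]]
  have adj: "inner (h_op hat e (x \<otimes> v)) (y \<otimes> u) = inner (x \<otimes> v) (h_op hat e (y \<otimes> u))"
    for x y v u
  proof -
    have "inner (h_op hat e (x \<otimes> v)) (y \<otimes> u) = inner x ((hat v * hat u) * y)"
      by (simp add: inner_h_op_pure[OF assms(2) hat(1)] inner_octonion_times_left
          oct_cnj_Im_times_Im hat(2))
    also have "\<dots> = inner (x \<otimes> v) (h_op hat e (y \<otimes> u))"
      using inner_h_op_pure[OF assms(2) hat(1), of y u x v] by (simp add: inner_commute)
    finally show ?thesis .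
  qed
  show ?thesis
  proof (induction s rule: tensor_induct)
    case (pure x v)
    show ?case
      by (induction t rule: tensor_induct) (simp_all add: adj lin inner_add_right)
  qed (simp add: lin inner_add_left)
qed

lemma h_op_G2_equivariant:
  assumes "isometric_identification hat" "orthonormal_basis e" "\<gamma> \<in> G2"
  shows "h_op hat e (G2_act_W hat \<gamma> t) = G2_act_W hat \<gamma> (h_op hat e t)"
proof (induction t rule: tensor_induct)
  case (pure x v)
  have hat: "linear hat"
    using assms(1) by (simp add: isometric_identification_def)
  have \<gamma>: "\<And>x y. \<gamma> (x * y) = \<gamma> x * \<gamma> y" "surj \<gamma>"
    using assms(3) by (auto simp: G2_def bij_def)
  show ?case
  proof (rule tensor_eqI_inner_pure)
    fix y' u'
    \<comment> \<open>It suffices to test against images under \<open>\<gamma>\<close>, where \<open>\<gamma>\<close> can be cancelled on both sides.\<close>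
    obtain y u where y': "y' = \<gamma> y" and u': "u' = G2_act_V hat \<gamma> u"
      using \<gamma>(2) surj_G2_act_V[OF assms(1,3)] by (metis surjD)
    have "inner (h_op hat e (G2_act_W hat \<gamma> (x \<otimes> v))) (y' \<otimes> u') =
        inner (\<gamma> ((hat u * hat v) * x)) (\<gamma> y)"
      by (simp add: y' u' G2_act_W_pure[OF assms(1,3)] inner_h_op_pure[OF assms(2) hat]
          hat_G2_act_V[OF assms(1,3)] \<gamma>(1))
    also have "\<dots> = inner (h_op hat e (x \<otimes> v)) (y \<otimes> u)"
      by (simp add: G2_inner[OF assms(3)] inner_h_op_pure[OF assms(2) hat])
    also have "\<dots> = inner (G2_act_W hat \<gamma> (h_op hat e (x \<otimes> v))) (y' \<otimes> u')"
      by (simp add: y' u' G2_act_W_inner[OF assms(1,3)] flip: G2_act_W_pure(2)[OF assms(1,3)])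
    finally show "inner (h_op hat e (G2_act_W hat \<gamma> (x \<otimes> v))) (y' \<otimes> u') =
        inner (G2_act_W hat \<gamma> (h_op hat e (x \<otimes> v))) (y' \<otimes> u')" .
  qed
qed (simp add: linear_add[OF linear_h_op[OF assms(2)]] linear_add[OF G2_act_W_pure(1)[OF assms(1,3)]])

theorem proposition3p2:
  fixes hat :: "'v::euclidean_space \<Rightarrow> octonion"
    and e :: "7 \<Rightarrow> 'v"
  assumes "DIM('v) = 7"
    and "isometric_identification hat"
    and "orthonormal_basis e"
  shows "linear (h_op hat e)
    \<and> (\<forall>s t. inner (h_op hat e s) t = inner s (h_op hat e t))
    \<and> (\<forall>\<gamma>\<in>G2. \<forall>t. h_op hat e (G2_act_W hat \<gamma> t) = G2_act_W hat \<gamma> (h_op hat e t))"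
  using linear_h_op[OF assms(3)] h_op_self_adjoint[OF assms(2,3)]
    h_op_G2_equivariant[OF assms(2,3)]
  by blast

end
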